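(* Let $\ell\ge 2$ be an integer and let $k_1,\dots,k_\ell$ be real numbers. Then $U(k_1,\dots,k_\ell)=0$.
   Context: A branch (of dimension $\ell$) is a nonzero vector $\alpha=(\alpha_1,\dots,\alpha_\ell)$ with all $\alpha_j\in\{0,1\}$. For such vectors write $\alpha<\beta$ iff $\alpha_j\le\beta_j$ for all $j=1,\dots,\ell$ and $\alpha_{j_0}<\beta_{j_0}$ for at least one $j_0$. A tree is a set $T=\{\alpha^{(1)},\dots,\alpha^{(m)}\}$ of branches with $\alpha^{(1)}<\alpha^{(2)}<\dots<\alpha^{(m)}$; then $|T|=m\le\ell$. $T(\ell)$ denotes the set of all trees formed by $\ell$-dimensional branches. (The empty tree contributes $0$ to the sum below.) For $k=(k_1,\dots,k_\ell)\in\mathbb{R}^\ell$ and $\alpha\cdot k=\sum_{j=1}^\ell\alpha_jk_j$, define $$U(k_1,\dots,k_\ell)=\sum_{T\in T(\ell)}(-1)^{|T|-1}\max\bigl(0,\ \alpha\cdot k\ :\ \alpha\in T\bigr),$$ where the maximum is over $0$ and all numbers $\alpha\cdot k$ with $\alpha\in T$. *)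

theory Defs
  imports Complex_Main "HOL-Library.FuncSet"
begin

text \<open>Vectors of dimension \<open>l\<close> are functions on the indices \<open>{1..l}\<close>. Branches are
  extensional on this set, so that equality of functions is equality of vectors and sets
  of branches are counted correctly.\<close>

definition branches :: "nat \<Rightarrow> (nat \<Rightarrow> nat) set" where
  "branches l = {\<alpha> \<in> {1..l} \<rightarrow>\<^sub>E {0, 1}. \<exists>j\<in>{1..l}. \<alpha> j \<noteq> 0}"

definition branch_less :: "nat \<Rightarrow> (nat \<Rightarrow> nat) \<Rightarrow> (nat \<Rightarrow> nat) \<Rightarrow> bool" where
  "branch_less l \<alpha> \<beta> \<longleftrightarrow> (\<forall>j\<in>{1..l}. \<alpha> j \<le> \<beta> j) \<and> (\<exists>j\<in>{1..l}. \<alpha> j < \<beta> j)"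

definition trees :: "nat \<Rightarrow> (nat \<Rightarrow> nat) set set" where
  "trees l = {set \<alpha>s | \<alpha>s. set \<alpha>s \<subseteq> branches l \<and> sorted_wrt (branch_less l) \<alpha>s}"

definition branch_dot :: "nat \<Rightarrow> (nat \<Rightarrow> nat) \<Rightarrow> (nat \<Rightarrow> real) \<Rightarrow> real" where
  "branch_dot l \<alpha> k = (\<Sum>j=1..l. real (\<alpha> j) * k j)"

text \<open>The empty tree belongs to \<open>trees l\<close>; its summand is \<open>0\<close> because the maximum
  over \<open>{0}\<close> is \<open>0\<close>. The exponent is an integer, so it is not truncated there.\<close>

definition U :: "nat \<Rightarrow> (nat \<Rightarrow> real) \<Rightarrow> real" where
  "U l k = (\<Sum>T\<in>trees l.
     (-1) powi (int (card T) - 1) * Max (insert 0 ((\<lambda>\<alpha>. branch_dot l \<alpha> k) ` T)))"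

lemma finite_branches: "finite (branches l)"
proof -
  have "finite ({1..l} \<rightarrow>\<^sub>E {0, 1::nat})"
    by (intro finite_PiE) auto
  then show ?thesis
    unfolding branches_def by simp
qed

lemma finite_trees: "finite (trees l)"
proof (rule finite_subset)
  show "trees l \<subseteq> Pow (branches l)"
    unfolding trees_def by auto
  show "finite (Pow (branches l))"
    using finite_branches by simp
qed

end

theory Submission
  imports Defs
begin

text \<open>Identify branches with nonempty subsets of \<open>{1..l}\<close> and trees with chains of such subsets.
  For an index \<open>j\<close>, let \<open>A\<close> be the largest member of the chain \<open>S\<close> avoiding \<open>j\<close> (or \<open>{}\<close>, if
  there is none). Adding or removing \<open>insert j A\<close> is an involution on chains that changes the
  parity of \<open>card S\<close>, so any alternating sum over chains of an invariant weight vanishes.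
  If \<open>k j < 0\<close> for some \<open>j\<close>, then the maximum is invariant under the involution for \<open>j\<close>, because
  \<open>insert j A\<close> has a smaller value than \<open>A\<close>. If all \<open>k i\<close> are nonnegative, then the maximum is
  the sum of the \<open>k i\<close> with \<open>i \<in> \<Union>S\<close>, and for each \<open>i\<close> the condition \<open>i \<in> \<Union>S\<close> is invariant
  under the involution for any \<open>j \<noteq> i\<close>.\<close>

section \<open>Chains of nonempty subsets and the toggling involution\<close>

definition subset_chains :: "'a set \<Rightarrow> 'a set set set" where
  "subset_chains X = {S. subset.chain (Pow X - {{}}) S}"

text \<open>Taking the union of the members avoiding \<open>j\<close> needs no choice of a largest
  one and yields \<open>{}\<close> when there is none.\<close>

definition pivot :: "'a \<Rightarrow> 'a set set \<Rightarrow> 'a set" where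
  "pivot j S = insert j (\<Union>{B\<in>S. j \<notin> B})"

definition toggle :: "'a \<Rightarrow> 'a set set \<Rightarrow> 'a set set" where
  "toggle j S = (if pivot j S \<in> S then S - {pivot j S} else insert (pivot j S) S)"

definition max_weight :: "('a \<Rightarrow> real) \<Rightarrow> 'a set set \<Rightarrow> real" where
  "max_weight k S = Max (insert 0 (sum k ` S))"

text \<open>The pivot contains \<open>j\<close>, so toggling it leaves alone the members avoiding
  \<open>j\<close>, and these alone determine the pivot.\<close>

lemma pivot_toggle [simp]: "pivot j (toggle j S) = pivot j S"
proof -
  have "{B\<in>toggle j S. j \<notin> B} = {B\<in>S. j \<notin> B}"
    by (auto simp: toggle_def pivot_def)
  then show ?thesis
    by (simp add: pivot_def)
qed

lemma toggle_toggle [simp]: "toggle j (toggle j S) = S"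
proof -
  have "toggle j (toggle j S) = (if pivot j S \<in> toggle j S then toggle j S - {pivot j S}
      else insert (pivot j S) (toggle j S))"
    by (simp add: toggle_def[of j "toggle j S"])
  also have "\<dots> = S"
    by (auto simp: toggle_def)
  finally show ?thesis .
qed

lemma subset_chains_finite:
  assumes "finite X" "S \<in> subset_chains X"
  shows "finite S"
  using assms by (auto simp: subset_chains_def subset_chain_def intro: finite_subset)

text \<open>A member containing \<open>j\<close> cannot lie inside one avoiding \<open>j\<close>, so
  it contains all of those and hence the pivot. A member avoiding \<open>j\<close> is one of the
  sets united in the pivot.\<close>

lemma pivot_comparable:
  assumes "subset.chain A S" "B \<in> S"
  shows "B \<subseteq> pivot j S \<or> pivot j S \<subseteq> B"
proof (cases "j \<in> B")
  case True
  then have "C \<subseteq> B" if "C \<in> S" "j \<notin> C" for C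
    using assms that unfolding subset_chain_def by blast
  with True show ?thesis
    by (auto simp: pivot_def)
next
  case False
  with assms(2) show ?thesis
    by (auto simp: pivot_def)
qed

lemma toggle_in_subset_chains:
  assumes S: "S \<in> subset_chains X" and j: "j \<in> X"
  shows "toggle j S \<in> subset_chains X"
proof -
  have "subset.chain (Pow X - {{}}) S"
    using S by (simp add: subset_chains_def)
  note cmp = pivot_comparable[OF this, of _ j]
  have "pivot j S \<in> Pow X - {{}}"
    using S j by (auto simp: pivot_def subset_chains_def subset_chain_def)
  then have "insert (pivot j S) S \<in> subset_chains X"
    using S cmp by (simp add: subset_chains_def subset_chain_insert disj_commute)
  moreover have "S - {pivot j S} \<in> subset_chains X"
    using S by (auto simp: subset_chains_def subset_chain_def)
  ultimately show ?thesis
    by (simp add: toggle_def)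
qed

lemma power_card_toggle:
  assumes "finite S"
  shows "(-1::real) ^ card (toggle j S) = - ((-1) ^ card S)"
proof (cases "pivot j S \<in> S")
  case True
  then have "card S = Suc (card (toggle j S))"
    using assms by (metis card.remove toggle_def)
  then show ?thesis by simp
next
  case False
  with assms show ?thesis by (simp add: toggle_def)
qed

text \<open>Reindexing by the involution \<open>toggle j\<close> flips every sign, so the sum equals
  its own negative.\<close>

lemma alternating_sum_toggle_invariant:
  fixes g :: "'a set set \<Rightarrow> real"
  assumes X: "finite X" "j \<in> X"
    and inv: "\<And>S. S \<in> subset_chains X \<Longrightarrow> g (toggle j S) = g S"
  shows "(\<Sum>S\<in>subset_chains X. (-1) ^ card S * g S) = 0"
proof -
  have "(\<Sum>S\<in>subset_chains X. (-1) ^ card S * g S)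
      = (\<Sum>S\<in>subset_chains X. - ((-1) ^ card S * g S))"
    by (rule sum.reindex_bij_witness[where i = "toggle j" and j = "toggle j"])
      (use X in \<open>auto simp: toggle_in_subset_chains inv power_card_toggle subset_chains_finite\<close>)
  then show ?thesis
    by (simp add: sum_negf)
qed

section \<open>Behaviour of the maximum under toggling\<close>

lemma max_weight_insert_dominated:
  assumes "finite S" "y \<in> insert 0 (sum k ` S)" "sum k M \<le> y"
  shows "max_weight k (insert M S) = max_weight k S"
proof -
  have "sum k M \<le> max_weight k S"
    unfolding max_weight_def using assms by (intro order_trans[OF assms(3)] Max_ge) auto
  moreover have "max_weight k (insert M S) = max (sum k M) (max_weight k S)"
    using assms(1) by (simp add: max_weight_def insert_commute[of 0])
  ultimately show ?thesis by simp
qed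

lemma max_weight_toggle:
  assumes X: "finite X" and S: "S \<in> subset_chains X" and neg: "k j < 0"
  shows "max_weight k (toggle j S) = max_weight k S"
proof -
  define A where "A = \<Union>{B\<in>S. j \<notin> B}"
  define M where "M = pivot j S"
  have M: "M = insert j A" and jA: "j \<notin> A"
    by (auto simp: M_def A_def pivot_def)
  have finS: "finite S"
    using X S by (rule subset_chains_finite)
  have "A \<subseteq> X"
    using S by (auto simp: A_def subset_chains_def subset_chain_def)
  then have "finite A"
    using X finite_subset by blast
  then have le: "sum k M \<le> sum k A"
    using M jA neg by simp
  \<comment> \<open>A nonempty finite chain contains its union. In the other case
    \<open>sum k A\<close> is the default entry 0 of the maximum.\<close>
  have "A = {} \<or> A \<in> S"
  proof (cases "{B\<in>S. j \<notin> B} = {}")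
    case True
    then show ?thesis unfolding A_def by blast
  next
    case False
    have "subset.chain UNIV {B\<in>S. j \<notin> B}"
      using S by (auto simp: subset_chains_def subset_chain_def)
    from Union_in_chain[OF _ False this] finS have "A \<in> {B\<in>S. j \<notin> B}"
      by (simp add: A_def)
    then show ?thesis by blast
  qed
  \<comment> \<open>Since \<open>j\<close> lies in \<open>M\<close> but not in \<open>A\<close>, the
    sets differ, so the dominating value survives the removal of \<open>M\<close>. Toggling merely
    switches between \<open>S - {M}\<close> and \<open>insert M (S - {M})\<close>.\<close>
  then have "sum k A \<in> insert 0 (sum k ` (S - {M}))"
    using M jA by auto
  then have "max_weight k (insert M (S - {M})) = max_weight k (S - {M})"
    using finS le by (intro max_weight_insert_dominated) auto
  then show ?thesis
    by (cases "M \<in> S") (simp_all add: toggle_def M_def[symmetric] insert_absorb)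
qed

text \<open>The union of a nonempty finite chain is its largest member, and nonnegative summands
  make \<open>sum k\<close> monotone. For the empty chain both sides are 0.\<close>

lemma max_weight_nonneg:
  assumes X: "finite X" and S: "S \<in> subset_chains X" and k: "\<And>i. i \<in> X \<Longrightarrow> k i \<ge> 0"
  shows "max_weight k S = sum k (\<Union>S)"
  unfolding max_weight_def
proof (rule Max_eqI)
  have finS: "finite S"
    using X S by (rule subset_chains_finite)
  then show "finite (insert 0 (sum k ` S))"
    by simp
  have sub: "\<Union>S \<subseteq> X"
    using S by (auto simp: subset_chains_def subset_chain_def)
  then have fin: "finite (\<Union>S)"
    using X finite_subset by blast
  show "y \<le> sum k (\<Union>S)" if "y \<in> insert 0 (sum k ` S)" for y
    using that sub k fin by (auto intro!: sum_nonneg sum_mono2)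
  show "sum k (\<Union>S) \<in> insert 0 (sum k ` S)"
  proof (cases "S = {}")
    case False
    with S finS show ?thesis
      using Union_in_chain[of S "Pow X - {{}}"] by (auto simp: subset_chains_def)
  qed simp
qed

text \<open>Apart from \<open>j\<close>, the pivot only has elements of members avoiding
  \<open>j\<close>, and those members are never toggled.\<close>

lemma mem_Union_toggle_iff:
  assumes "i \<noteq> j"
  shows "i \<in> \<Union>(toggle j S) \<longleftrightarrow> i \<in> \<Union>S"
proof -
  have "j \<in> pivot j S" "i \<in> pivot j S \<longleftrightarrow> (\<exists>B\<in>S. j \<notin> B \<and> i \<in> B)"
    using assms by (auto simp: pivot_def)
  then show ?thesis
    unfolding toggle_def by (auto split: if_splits)
qed

lemma alternating_sum_max_weight:
  fixes k :: "'a \<Rightarrow> real"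
  assumes X: "finite X" "card X \<ge> 2"
  shows "(\<Sum>S\<in>subset_chains X. (-1) ^ card S * max_weight k S) = 0"
proof (cases "\<exists>j\<in>X. k j < 0")
  case True
  then show ?thesis
    using X alternating_sum_toggle_invariant[of X _ "max_weight k"] max_weight_toggle[of X]
    by blast
next
  case False
  \<comment> \<open>Splitting the weight by index allows a different involution for each
    \<open>i\<close>.\<close>
  have "(\<Sum>S\<in>subset_chains X. (-1) ^ card S * max_weight k S)
      = (\<Sum>S\<in>subset_chains X. \<Sum>i\<in>X. (-1) ^ card S * (of_bool (i \<in> \<Union>S) * k i))"
  proof (rule sum.cong[OF refl])
    fix S assume S: "S \<in> subset_chains X"
    then have "X \<inter> \<Union>S = \<Union>S"
      by (auto simp: subset_chains_def subset_chain_def)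
    moreover have "(\<Sum>i\<in>X. of_bool (i \<in> \<Union>S) * k i) = sum k (X \<inter> \<Union>S)"
      using X by (simp add: sum.inter_restrict of_bool_def if_distrib[of "\<lambda>x. x * _"] cong: if_cong)
    ultimately show "(-1) ^ card S * max_weight k S
        = (\<Sum>i\<in>X. (-1) ^ card S * (of_bool (i \<in> \<Union>S) * k i))"
      using max_weight_nonneg[OF X(1) S, of k] False
      by (simp add: not_less flip: sum_distrib_left)
  qed
  also have "\<dots> = (\<Sum>i\<in>X. \<Sum>S\<in>subset_chains X. (-1) ^ card S * (of_bool (i \<in> \<Union>S) * k i))"
    by (rule sum.swap)
  also have "\<dots> = 0"
  proof (rule sum.neutral, rule ballI)
    fix i assume "i \<in> X"
    \<comment> \<open>Here \<open>card X \<ge> 2\<close> enters: it supplies an index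
      \<open>j\<close> other than \<open>i\<close> to toggle with.\<close>
    then have "X - {i} \<noteq> {}"
      using X by (metis One_nat_def card_1_singleton_iff card_Diff_singleton card.empty
          diff_is_0_eq not_less_eq_eq numeral_2_eq_2)
    then obtain j where "j \<in> X" "j \<noteq> i"
      by blast
    then show "(\<Sum>S\<in>subset_chains X. (-1) ^ card S * (of_bool (i \<in> \<Union>S) * k i)) = 0"
      using X by (intro alternating_sum_toggle_invariant[where j = j])
        (auto simp: mem_Union_toggle_iff simp del: Union_iff)
  qed
  finally show ?thesis .
qed

section \<open>Trees of branches as chains of subsets\<close>

text \<open>The indicator vector is restricted so as to be extensional on \<open>{1..l}\<close>, as
  members of \<open>branches l\<close> are.\<close>

definition branch_of :: "nat \<Rightarrow> nat set \<Rightarrow> nat \<Rightarrow> nat" where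
  "branch_of l A = restrict (\<lambda>j. of_bool (j \<in> A)) {1..l}"

lemma branch_less_branch_of_iff:
  assumes "A \<subseteq> {1..l}" "B \<subseteq> {1..l}"
  shows "branch_less l (branch_of l A) (branch_of l B) \<longleftrightarrow> A \<subset> B"
  using assms by (auto simp: branch_less_def branch_of_def)

lemma inj_on_branch_of: "inj_on (branch_of l) (Pow {1..l})"
proof (rule inj_onI)
  fix A B assume "A \<in> Pow {1..l}" "B \<in> Pow {1..l}" and eq: "branch_of l A = branch_of l B"
  have "j \<in> A \<longleftrightarrow> j \<in> B" if "j \<in> {1..l}" for j
    using fun_cong[OF eq, of j] that by (simp add: branch_of_def of_bool_eq_iff)
  with \<open>A \<in> _\<close> \<open>B \<in> _\<close> show "A = B"
    by blast
qed

lemma branches_eq_image: "branches l = branch_of l ` (Pow {1..l} - {{}})"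
proof (intro equalityI subsetI)
  fix \<alpha> assume \<alpha>: "\<alpha> \<in> branches l"
  let ?A = "{j\<in>{1..l}. \<alpha> j \<noteq> 0}"
  have "\<alpha> = branch_of l ?A"
  proof
    fix j
    show "\<alpha> j = branch_of l ?A j"
    proof (cases "j \<in> {1..l}")
      case True
      with \<alpha> have "\<alpha> j \<in> {0, 1}"
        by (auto simp: branches_def)
      with True show ?thesis by (auto simp: branch_of_def)
    next
      case False
      with \<alpha> show ?thesis
        by (auto simp: branches_def branch_of_def PiE_def extensional_def)
    qed
  qed
  moreover have "?A \<in> Pow {1..l} - {{}}"
    using \<alpha> by (auto simp: branches_def)
  ultimately show "\<alpha> \<in> branch_of l ` (Pow {1..l} - {{}})"
    by blast
next
  fix \<alpha> assume "\<alpha> \<in> branch_of l ` (Pow {1..l} - {{}})"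
  then show "\<alpha> \<in> branches l"
    by (force simp: branches_def branch_of_def)
qed

lemma branch_dot_branch_of:
  assumes "A \<subseteq> {1..l}"
  shows "branch_dot l (branch_of l A) k = sum k A"
proof -
  have "branch_dot l (branch_of l A) k = (\<Sum>j\<in>{1..l}. if j \<in> A then k j else 0)"
    unfolding branch_dot_def by (rule sum.cong) (auto simp: branch_of_def)
  also have "\<dots> = sum k ({1..l} \<inter> A)"
    by (simp add: sum.inter_restrict)
  finally show ?thesis
    using assms by (simp add: Int_absorb1)
qed

text \<open>Trees are given by sorted lists, chains by pairwise comparability. Sorting by
  cardinality links the two, since comparable distinct finite sets are strictly included in the
  order of their sizes.\<close>

lemma finite_chain_sorted_list:
  assumes "finite S" "\<And>A. A \<in> S \<Longrightarrow> finite A" "subset.chain UNIV S"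
  obtains xs where "set xs = S" "sorted_wrt (\<subset>) xs"
proof -
  obtain ys where ys: "set ys = S" "distinct ys"
    using finite_distinct_list[OF assms(1)] by blast
  let ?xs = "sort_key card ys"
  have "sorted_wrt (\<lambda>A B. card A \<le> card B) ?xs" "distinct ?xs"
    using sorted_sort_key[of card ys] ys(2)
    by (simp_all add: sorted_map distinct_sort)
  then have "sorted_wrt (\<lambda>A B. card A \<le> card B \<and> A \<noteq> B) ?xs"
    by (simp add: sorted_wrt_iff_nth_less distinct_conv_nth)
  moreover have "A \<subset> B" if "A \<in> S" "B \<in> S" "card A \<le> card B \<and> A \<noteq> B" for A B
  proof -
    have "A \<subseteq> B \<or> B \<subseteq> A"
      using that assms(3) by (auto simp: subset_chain_def)
    then show ?thesis
      using that assms(2) card_seteq[of A B] by blast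
  qed
  ultimately have "sorted_wrt (\<subset>) ?xs"
    using ys(1) sorted_wrt_mono_rel[of ?xs "\<lambda>A B. card A \<le> card B \<and> A \<noteq> B" "(\<subset>)"] by simp
  with ys(1) that[of ?xs] show ?thesis
    by simp
qed

lemma sorted_wrt_psubset_chain:
  assumes "sorted_wrt (\<subset>) xs"
  shows "subset.chain UNIV (set xs)"
  using assms by (induction xs) (auto simp: subset_chain_def)

lemma trees_eq_image: "trees l = image (branch_of l) ` subset_chains {1..l}"
proof (intro equalityI subsetI)
  fix T assume "T \<in> trees l"
  then obtain \<alpha>s where T: "T = set \<alpha>s" "set \<alpha>s \<subseteq> branches l" "sorted_wrt (branch_less l) \<alpha>s"
    by (auto simp: trees_def)
  then have "\<alpha>s \<in> lists (branch_of l ` (Pow {1..l} - {{}}))"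
    by (simp add: branches_eq_image in_lists_conv_set subset_iff)
  then have "\<alpha>s \<in> map (branch_of l) ` lists (Pow {1..l} - {{}})"
    by (simp only: lists_image)
  then obtain As where As: "set As \<subseteq> Pow {1..l} - {{}}" "\<alpha>s = map (branch_of l) As"
    by (auto simp: lists_eq_set)
  have "sorted_wrt (\<lambda>A B. branch_less l (branch_of l A) (branch_of l B)) As"
    using T(3) by (simp add: As(2) sorted_wrt_map)
  then have "sorted_wrt (\<subset>) As"
  proof (rule sorted_wrt_mono_rel[rotated])
    fix A B assume "A \<in> set As" "B \<in> set As" "branch_less l (branch_of l A) (branch_of l B)"
    moreover from this have "A \<subseteq> {1..l}" "B \<subseteq> {1..l}"
      using As(1) by auto
    ultimately show "A \<subset> B"
      by (simp add: branch_less_branch_of_iff)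
  qed
  from sorted_wrt_psubset_chain[OF this] As(1) have "set As \<in> subset_chains {1..l}"
    by (simp add: subset_chains_def subset_chain_def)
  with T(1) As(2) show "T \<in> image (branch_of l) ` subset_chains {1..l}"
    by auto
next
  fix T assume "T \<in> image (branch_of l) ` subset_chains {1..l}"
  then obtain S where S: "S \<in> subset_chains {1..l}" "T = branch_of l ` S"
    by blast
  have sub: "S \<subseteq> Pow {1..l} - {{}}"
    using S by (simp add: subset_chains_def subset_chain_def)
  obtain As where As: "set As = S" "sorted_wrt (\<subset>) As"
  proof (rule finite_chain_sorted_list)
    show "finite S"
      using S(1) by (rule subset_chains_finite[rotated]) simp
    show "finite A" if "A \<in> S" for A
      using that sub by (auto intro: finite_subset)
    show "subset.chain UNIV S"
      using S by (simp add: subset_chains_def subset_chain_def)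
  qed
  have "sorted_wrt (branch_less l) (map (branch_of l) As)"
    unfolding sorted_wrt_map using As(2)
  proof (rule sorted_wrt_mono_rel[rotated])
    fix A B assume "A \<in> set As" "B \<in> set As" "A \<subset> B"
    moreover from this have "A \<subseteq> {1..l}" "B \<subseteq> {1..l}"
      using As(1) sub by auto
    ultimately show "branch_less l (branch_of l A) (branch_of l B)"
      by (simp add: branch_less_branch_of_iff)
  qed
  moreover have "set (map (branch_of l) As) = T" "T \<subseteq> branches l"
    using As(1) S(2) sub by (auto simp: branches_eq_image)
  ultimately show "T \<in> trees l"
    unfolding trees_def by blast
qed

lemma U_eq_alternating_sum:
  "U l k = - (\<Sum>S\<in>subset_chains {1..l}. (-1) ^ card S * max_weight k S)"
proof -
  have sub: "subset_chains {1..l} \<subseteq> Pow (Pow {1..l})"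
    by (auto simp: subset_chains_def subset_chain_def)
  have "U l k = (\<Sum>S\<in>subset_chains {1..l}. (-1) powi (int (card (branch_of l ` S)) - 1) *
      Max (insert 0 ((\<lambda>\<alpha>. branch_dot l \<alpha> k) ` branch_of l ` S)))"
    \<comment> \<open>Injectivity of \<open>branch_of l\<close> on subsets lifts to families of
      subsets, so each tree arises from exactly one chain.\<close>
    unfolding U_def trees_eq_image
    by (rule sum.reindex[unfolded o_def])
      (rule inj_on_subset[OF inj_on_image_Pow[OF inj_on_branch_of] sub])
  also have "\<dots> = (\<Sum>S\<in>subset_chains {1..l}. - ((-1) ^ card S * max_weight k S))"
  proof (rule sum.cong[OF refl])
    fix S assume "S \<in> subset_chains {1..l}"
    with sub have S: "S \<subseteq> Pow {1..l}"
      by blast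
    have "card (branch_of l ` S) = card S"
      by (rule card_image[OF inj_on_subset[OF inj_on_branch_of S]])
    moreover have "(\<lambda>\<alpha>. branch_dot l \<alpha> k) ` branch_of l ` S = sum k ` S"
      unfolding image_image using S by (intro image_cong) (auto simp: branch_dot_branch_of)
    \<comment> \<open>This includes \<open>n = 0\<close>, where the exponent is -1 and both sides
      are -1.\<close>
    moreover have "(-1::real) powi (int n - 1) = - ((-1) ^ n)" for n
      by (simp add: power_int_diff)
    ultimately show "(-1) powi (int (card (branch_of l ` S)) - 1) *
        Max (insert 0 ((\<lambda>\<alpha>. branch_dot l \<alpha> k) ` branch_of l ` S))
        = - ((-1) ^ card S * max_weight k S)"
      by (simp add: max_weight_def)
  qed
  finally show ?thesis
    by (simp add: sum_negf)
qed

theorem proposition2: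
  fixes l :: nat and k :: "nat \<Rightarrow> real"
  assumes "l \<ge> 2"
  shows "U l k = 0"
  using assms by (simp add: U_eq_alternating_sum alternating_sum_max_weight)

end
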